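(* Let $(\Gamma,\alpha)$ be an abstract 1-skeleton of type $(k,n)$ such that $\alpha$ is $l$-independent, where $1<l\le k$. Then for every vertex $p\in V_\Gamma$, any $m$ $(<l)$ edges $e_1,\dots,e_m$ of $E_p$ can be extended to a unique $m$-face, i.e. there is exactly one $m$-dimensional face of $(\Gamma,\alpha)$ containing $e_1,\dots,e_m$. In particular, when $k=n$, for every $p\in V_\Gamma$ any $m$ $(\le n)$ edges of $E_p$ can always be extended to a unique $m$-face.
   Context: Let $G=(\mathbb{Z}_2)^k$, $k\ge1$. $\mathrm{Hom}(G,\mathbb{Z}_2)$ is regarded as a $k$-dimensional vector space over $\mathbb{Z}_2$ with zero element $\rho_0$. An abstract 1-skeleton of type $(k,n)$ (with $n\ge k$) is a pair $(\Gamma,\alpha)$ where $\Gamma$ is a finite $n$-valent regular graph without loops (multiple edges allowed), with vertex set $V_\Gamma$ and edge set $E_\Gamma$, and $\alpha:E_\Gamma\to\mathrm{Hom}(G,\mathbb{Z}_2)\setminus\{\rho_0\}$ is a map such that, with $E_p$ the set of edges adjacent to the vertex $p$ and $\alpha(E_p)$ the multiset of values of $\alpha$ on $E_p$: (1) for each $p\in V_\Gamma$, $\alpha(E_p)$ spans $\mathrm{Hom}(G,\mathbb{Z}_2)$; (2) for each edge $e$ with endpoints $p,q$, $\alpha(E_p)\equiv\alpha(E_q)\bmod\alpha(e)$, i.e. the two multisets have the same image in $\mathrm{Hom}(G,\mathbb{Z}_2)/\langle\alpha(e)\rangle$. $\alpha$ is $l$-independent if for each vertex $p$ the colors of any $l$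 distinct edges in $E_p$ are linearly independent in $\mathrm{Hom}(G,\mathbb{Z}_2)$. For $0\le\ell\le n$, an $\ell$-dimensional face ($\ell$-face) of $(\Gamma,\alpha)$ is a pair $(\Gamma',\alpha|_{\Gamma'})$ with $\Gamma'$ a connected $\ell$-valent subgraph of $\Gamma$ for which there is a subspace $K$ of $\mathrm{Hom}(G,\mathbb{Z}_2)$ such that (writing $E_p|_{\Gamma'}$ for the edges of $\Gamma'$ adjacent to $p$) (1) for each vertex $p\in V_{\Gamma'}$, $\alpha(E_p|_{\Gamma'})$ spans $K$, and (2) for each edge $e=pq$ of $\Gamma'$, $\alpha(E_p|_{\Gamma'})\equiv\alpha(E_q|_{\Gamma'})\bmod\alpha(e)$ as multisets. *)

theory Defs
  imports "HOL-Analysis.Analysis" "HOL-Library.Z2" "HOL-Library.Function_Algebras"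
    "HOL-Library.Multiset"
begin

section \<open>Finite multigraphs without loops\<close>

text \<open>An edge is mapped to its two-element set of endpoints, so loops are excluded and
  parallel edges are allowed.\<close>

record ('v, 'e) mgraph =
  verts :: "'v set"
  edges :: "'e set"
  ends :: "'e \<Rightarrow> 'v set"

definition finite_mgraph :: "('v, 'e) mgraph \<Rightarrow> bool" where
  "finite_mgraph \<Gamma> \<longleftrightarrow> finite (verts \<Gamma>) \<and> finite (edges \<Gamma>) \<and>
     (\<forall>e\<in>edges \<Gamma>. ends \<Gamma> e \<subseteq> verts \<Gamma> \<and> card (ends \<Gamma> e) = 2)"

definition edges_at :: "('v, 'e) mgraph \<Rightarrow> 'v \<Rightarrow> 'e set" where
  "edges_at \<Gamma> p = {e \<in> edges \<Gamma>. p \<in> ends \<Gamma> e}"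

definition valent :: "nat \<Rightarrow> ('v, 'e) mgraph \<Rightarrow> bool" where
  "valent n \<Gamma> \<longleftrightarrow> (\<forall>p\<in>verts \<Gamma>. card (edges_at \<Gamma> p) = n)"

definition adjacency :: "('v, 'e) mgraph \<Rightarrow> ('v \<times> 'v) set" where
  "adjacency \<Gamma> = {(p, q). \<exists>e\<in>edges \<Gamma>. ends \<Gamma> e = {p, q}}"

definition connected_mgraph :: "('v, 'e) mgraph \<Rightarrow> bool" where
  "connected_mgraph \<Gamma> \<longleftrightarrow>
     verts \<Gamma> \<noteq> {} \<and> (\<forall>p\<in>verts \<Gamma>. \<forall>q\<in>verts \<Gamma>. (p, q) \<in> (adjacency \<Gamma>)\<^sup>*)"

text \<open>A subgraph keeps the whole endpoint function, including its irrelevant values outside the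
  edge set. Hence subgraphs with the same vertices and edges are equal as records, and
  counting subgraphs is meaningful.\<close>

definition subgraph :: "('v, 'e) mgraph \<Rightarrow> ('v, 'e) mgraph \<Rightarrow> bool" where
  "subgraph \<Gamma>' \<Gamma> \<longleftrightarrow> finite_mgraph \<Gamma>' \<and>
     verts \<Gamma>' \<subseteq> verts \<Gamma> \<and> edges \<Gamma>' \<subseteq> edges \<Gamma> \<and> ends \<Gamma>' = ends \<Gamma>"


section \<open>The vector space of homomorphisms from a power of the two-element group\<close>

text \<open>The group \<open>G\<close> is \<open>bit ^ 'k\<close>, of rank \<open>k = CARD('k)\<close>. \<open>Hom(G, Z_2)\<close> is a subspace of the space
  of all functions from \<open>G\<close> to \<open>bit\<close> with pointwise operations; spans and linear independence
  of homomorphisms are the same in either space.\<close>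

definition fun_scale :: "bit \<Rightarrow> ('g \<Rightarrow> bit) \<Rightarrow> 'g \<Rightarrow> bit" where
  "fun_scale c \<rho> = (\<lambda>x. c * \<rho> x)"

global_interpretation fun_space: vector_space "fun_scale :: bit \<Rightarrow> ('g \<Rightarrow> bit) \<Rightarrow> 'g \<Rightarrow> bit"
  by unfold_locales (simp_all only: fun_scale_def fun_eq_iff plus_fun_def distrib_left distrib_right
      mult.assoc mult_1_left simp_thms)

definition Hom :: "(bit ^ 'k \<Rightarrow> bit) set" where
  "Hom = {\<rho>. \<forall>x y. \<rho> (x + y) = \<rho> x + \<rho> y}"

lemma subspace_Hom: "fun_space.subspace Hom"
  unfolding fun_space.subspace_def
  by (simp only: Hom_def fun_scale_def mem_Collect_eq plus_fun_def zero_fun_def Ball_def,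
      intro conjI allI impI) (simp_all only: distrib_left add_0_left ac_simps)


section \<open>Abstract 1-skeletons and their faces\<close>

definition colors :: "('e \<Rightarrow> 'h) \<Rightarrow> 'e set \<Rightarrow> 'h multiset" where
  "colors \<alpha> A = image_mset \<alpha> (mset_set A)"

text \<open>Equality of the images in the quotient by the line spanned by \<open>\<rho>\<close>, whose elements are the
  cosets \<open>\<sigma> + span {\<rho>}\<close>.\<close>

definition mset_cong_mod :: "('g \<Rightarrow> bit) multiset \<Rightarrow> ('g \<Rightarrow> bit) multiset \<Rightarrow> ('g \<Rightarrow> bit) \<Rightarrow> bool" where
  "mset_cong_mod M N \<rho> \<longleftrightarrow>
     image_mset (\<lambda>\<sigma>. (+) \<sigma> ` fun_space.span {\<rho>}) M =
     image_mset (\<lambda>\<sigma>. (+) \<sigma> ` fun_space.span {\<rho>}) N"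

definition color_compatible :: "('v, 'e) mgraph \<Rightarrow> ('e \<Rightarrow> bit ^ 'k \<Rightarrow> bit) \<Rightarrow> bool" where
  "color_compatible \<Gamma> \<alpha> \<longleftrightarrow>
     (\<forall>e\<in>edges \<Gamma>. \<forall>p q. ends \<Gamma> e = {p, q} \<longrightarrow>
        mset_cong_mod (colors \<alpha> (edges_at \<Gamma> p)) (colors \<alpha> (edges_at \<Gamma> q)) (\<alpha> e))"

text \<open>Type \<open>(k, n)\<close>, where \<open>k = CARD('k) \<ge> 1\<close> is read off from the type of the coloring.\<close>

definition abstract_1_skeleton ::
  "nat \<Rightarrow> ('v, 'e) mgraph \<Rightarrow> ('e \<Rightarrow> bit ^ 'k \<Rightarrow> bit) \<Rightarrow> bool" where
  "abstract_1_skeleton n \<Gamma> \<alpha> \<longleftrightarrow>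
     CARD('k) \<le> n \<and> finite_mgraph \<Gamma> \<and> valent n \<Gamma> \<and>
     \<alpha> ` edges \<Gamma> \<subseteq> Hom - {0} \<and>
     (\<forall>p\<in>verts \<Gamma>. fun_space.span (\<alpha> ` edges_at \<Gamma> p) = Hom) \<and>
     color_compatible \<Gamma> \<alpha>"

text \<open>Independence is that of the family of colors, so distinct edges must in particular have
  distinct colors.\<close>

definition l_independent ::
  "nat \<Rightarrow> ('v, 'e) mgraph \<Rightarrow> ('e \<Rightarrow> bit ^ 'k \<Rightarrow> bit) \<Rightarrow> bool" where
  "l_independent l \<Gamma> \<alpha> \<longleftrightarrow>
     (\<forall>p\<in>verts \<Gamma>. \<forall>A. A \<subseteq> edges_at \<Gamma> p \<and> card A = l \<longrightarrow>
        inj_on \<alpha> A \<and> fun_space.independent (\<alpha> ` A))"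

text \<open>The coloring of a face is the restriction of \<open>\<alpha>\<close> and is determined by the subgraph, so a
  face is identified with its underlying subgraph. The dimension is automatically at most
  the valency of \<open>\<Gamma>\<close>, since connected graphs are nonempty.\<close>

definition face ::
  "nat \<Rightarrow> ('v, 'e) mgraph \<Rightarrow> ('e \<Rightarrow> bit ^ 'k \<Rightarrow> bit) \<Rightarrow> ('v, 'e) mgraph \<Rightarrow> bool" where
  "face d \<Gamma> \<alpha> \<Gamma>' \<longleftrightarrow>
     subgraph \<Gamma>' \<Gamma> \<and> connected_mgraph \<Gamma>' \<and> valent d \<Gamma>' \<and>
     (\<exists>K. fun_space.subspace K \<and> K \<subseteq> Hom \<and>
        (\<forall>p\<in>verts \<Gamma>'. fun_space.span (\<alpha> ` edges_at \<Gamma>' p) = K)) \<and>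
     color_compatible \<Gamma>' \<alpha>"

end

theory Submission
  imports Defs
begin

text \<open>If \<open>K\<close> is the span of the colors of \<open>S\<close>, the face is the connected component of \<open>p\<close> in the
  graph of all edges with color in \<open>K\<close>. Since membership in \<open>K\<close> is constant on cosets of \<open>\<alpha> e\<close> when
  \<open>\<alpha> e \<in> K\<close>, the congruence along such an edge restricts to the edges with color in \<open>K\<close>. So the
  number \<open>m\<close> of these edges is constant on the component, and by independence they span \<open>K\<close>
  everywhere. No connection on the edges is needed. Conversely, the edges of any
  \<open>m\<close>-face through \<open>S\<close> have colors in \<open>K\<close>, and counting them at each vertex leaves no choice.\<close>

section \<open>Connected components and connected subgraphs of multigraphs\<close>

definition color_subgraph ::
  "('v, 'e) mgraph \<Rightarrow> ('e \<Rightarrow> 'g \<Rightarrow> bit) \<Rightarrow> ('g \<Rightarrow> bit) set \<Rightarrow> ('v, 'e) mgraph" where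
  "color_subgraph \<Gamma> \<alpha> K = \<lparr>verts = verts \<Gamma>, edges = {e \<in> edges \<Gamma>. \<alpha> e \<in> K}, ends = ends \<Gamma>\<rparr>"

text \<open>The vertex set is not cut down to \<open>verts \<Gamma>\<close>, so \<open>p\<close>
  always belongs to it; \<open>reachable_in_verts\<close> gives the inclusion when \<open>p\<close>
  is a vertex. Keeping \<open>ends\<close> whole is what \<open>subgraph\<close> demands.\<close>

definition component :: "('v, 'e) mgraph \<Rightarrow> 'v \<Rightarrow> ('v, 'e) mgraph" where
  "component \<Gamma> p =
     \<lparr>verts = {q. (p, q) \<in> (adjacency \<Gamma>)\<^sup>*},
      edges = {e \<in> edges \<Gamma>. ends \<Gamma> e \<subseteq> {q. (p, q) \<in> (adjacency \<Gamma>)\<^sup>*}},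
      ends = ends \<Gamma>\<rparr>"

lemma finite_edges_at: "finite_mgraph \<Gamma> \<Longrightarrow> finite (edges_at \<Gamma> p)"
  by (simp add: finite_mgraph_def edges_at_def)

lemma ends_eq_pair:
  assumes "finite_mgraph \<Gamma>" "e \<in> edges_at \<Gamma> p"
  obtains q where "ends \<Gamma> e = {p, q}"
proof -
  have "card (ends \<Gamma> e) = 2" "p \<in> ends \<Gamma> e"
    using assms by (auto simp: finite_mgraph_def edges_at_def)
  then show thesis using that by (metis card_2_iff insertE insert_commute singletonD)
qed

lemma sym_adjacency: "sym (adjacency \<Gamma>)"
  by (auto simp: sym_def adjacency_def insert_commute)

lemma reachable_in_verts:
  assumes "finite_mgraph \<Gamma>" "p \<in> verts \<Gamma>" "(p, q) \<in> (adjacency \<Gamma>)\<^sup>*"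
  shows "q \<in> verts \<Gamma>"
  using assms(3,2) by induction (use assms(1) in \<open>auto simp: adjacency_def finite_mgraph_def\<close>)

text \<open>The far endpoint of an edge at a reachable vertex is again reachable, so passing to the
  component loses no edge there.\<close>

lemma edges_at_component:
  assumes "finite_mgraph \<Gamma>" "q \<in> verts (component \<Gamma> p)"
  shows "edges_at (component \<Gamma> p) q = edges_at \<Gamma> q"
proof -
  have "ends \<Gamma> e \<subseteq> verts (component \<Gamma> p)" if e: "e \<in> edges_at \<Gamma> q" for e
  proof -
    obtain r where r: "ends \<Gamma> e = {q, r}" using ends_eq_pair[OF assms(1) e] by blast
    then have "(q, r) \<in> adjacency \<Gamma>" using e by (auto simp: adjacency_def edges_at_def)
    then show ?thesis using assms(2) r by (auto simp: component_def)
  qed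
  then show ?thesis by (auto simp: edges_at_def component_def)
qed

lemma subgraph_component:
  assumes "finite_mgraph \<Gamma>" "p \<in> verts \<Gamma>"
  shows "subgraph (component \<Gamma> p) \<Gamma>"
proof -
  have "verts (component \<Gamma> p) \<subseteq> verts \<Gamma>"
    using reachable_in_verts[OF assms] by (auto simp: component_def)
  then show ?thesis using assms
    by (auto simp: subgraph_def finite_mgraph_def component_def intro: finite_subset)
qed

text \<open>A walk from \<open>p\<close> visits only reachable vertices, hence stays inside the
  component. Symmetry of adjacency then joins any two vertices through \<open>p\<close>.\<close>

lemma connected_component: "connected_mgraph (component \<Gamma> p)"
proof -
  let ?C = "component \<Gamma> p"
  have from_p: "(p, q) \<in> (adjacency ?C)\<^sup>*" if "(p, q) \<in> (adjacency \<Gamma>)\<^sup>*" for q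
    using that
  proof induction
    case (step q r)
    have "(p, r) \<in> (adjacency \<Gamma>)\<^sup>*" using step.hyps by (rule rtrancl_into_rtrancl)
    moreover obtain e where "e \<in> edges \<Gamma>" "ends \<Gamma> e = {q, r}"
      using step.hyps(2) by (auto simp: adjacency_def)
    ultimately have "e \<in> edges ?C" "ends ?C e = {q, r}"
      using step.hyps(1) by (simp_all add: component_def)
    then have "(q, r) \<in> adjacency ?C" by (auto simp: adjacency_def)
    with step.IH show ?case by (rule rtrancl_into_rtrancl)
  qed simp
  have "(q, p) \<in> (adjacency ?C)\<^sup>*" if "(p, q) \<in> (adjacency \<Gamma>)\<^sup>*" for q
    using from_p[OF that] sym_rtrancl[OF sym_adjacency] by (rule symD[rotated])
  then have "(q, r) \<in> (adjacency ?C)\<^sup>*" if "q \<in> verts ?C" "r \<in> verts ?C" for q r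
    using that from_p[of r] rtrancl_trans[of q p _ r] by (simp add: component_def)
  moreover have "p \<in> verts ?C" by (simp add: component_def)
  ultimately show ?thesis unfolding connected_mgraph_def by blast
qed

text \<open>A walk from \<open>p\<close> in one subgraph never leaves the other, because the edges
  at each common vertex agree. Agreement is asked only at common vertices, since the edge count that
  will provide it is available only there.\<close>

lemma connected_subgraph_eqI:
  assumes sub: "subgraph \<Gamma>1 \<Gamma>" "subgraph \<Gamma>2 \<Gamma>"
    and conn: "connected_mgraph \<Gamma>1" "connected_mgraph \<Gamma>2"
    and p: "p \<in> verts \<Gamma>1" "p \<in> verts \<Gamma>2"
    and eq: "\<And>q. q \<in> verts \<Gamma>1 \<Longrightarrow> q \<in> verts \<Gamma>2 \<Longrightarrow> edges_at \<Gamma>1 q = edges_at \<Gamma>2 q"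
  shows "\<Gamma>1 = \<Gamma>2"
proof -
  have fin: "finite_mgraph \<Gamma>1" "finite_mgraph \<Gamma>2" and ends: "ends \<Gamma>1 = ends \<Gamma>2"
    using sub by (auto simp: subgraph_def)
  \<comment> \<open>Stated for arbitrary \<open>A\<close> and \<open>B\<close>, so that it can be
    applied in both directions.\<close>
  have verts_subset: "verts A \<subseteq> verts B"
    if fin: "finite_mgraph A" "finite_mgraph B" and ends: "ends A = ends B"
      and conn: "connected_mgraph A" and p: "p \<in> verts A" "p \<in> verts B"
      and eq: "\<And>q. q \<in> verts A \<Longrightarrow> q \<in> verts B \<Longrightarrow> edges_at A q = edges_at B q"
    for A B :: "('a, 'b) mgraph"
  proof
    fix q assume "q \<in> verts A"
    then have "(p, q) \<in> (adjacency A)\<^sup>*" using conn p(1) by (simp add: connected_mgraph_def)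
    then have "q \<in> verts A \<and> q \<in> verts B"
    proof induction
      case (step q r)
      then obtain e where "e \<in> edges A" and e: "ends A e = {q, r}"
        by (auto simp: adjacency_def)
      then have "e \<in> edges_at A q" by (simp add: edges_at_def)
      then have "e \<in> edges A" "e \<in> edges B" using eq step.IH by (auto simp: edges_at_def)
      then have "{q, r} \<subseteq> verts A" "{q, r} \<subseteq> verts B"
        using fin e ends unfolding finite_mgraph_def by metis+
      then show ?case by simp
    qed (use p in simp)
    then show "q \<in> verts B" ..
  qed
  have verts: "verts \<Gamma>1 = verts \<Gamma>2"
    using verts_subset[OF fin ends conn(1) p eq]
      verts_subset[OF fin(2,1) ends[symmetric] conn(2) p(2,1) eq[symmetric]] by blast
  \<comment> \<open>Every edge has an endpoint among the vertices, so the edge set is recovered from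
    the edges at the vertices.\<close>
  have "edges A = (\<Union>q\<in>verts A. edges_at A q)" if fin: "finite_mgraph A" for A :: "('a, 'b) mgraph"
  proof -
    have "\<exists>q\<in>verts A. q \<in> ends A e" if "e \<in> edges A" for e
    proof -
      have "ends A e \<noteq> {}" "ends A e \<subseteq> verts A" using fin that by (auto simp: finite_mgraph_def)
      then show ?thesis by blast
    qed
    then show ?thesis by (auto simp: edges_at_def)
  qed
  then have "edges \<Gamma>1 = edges \<Gamma>2" using fin eq verts by simp
  with verts ends show ?thesis by simp
qed

section \<open>Restricting colors to a subspace, and congruence modulo a color\<close>

text \<open>Turns membership in \<open>K\<close> into a property of the coset alone, so that
  selecting the colors in \<open>K\<close> makes sense in the quotient.\<close>

lemma coset_subset_subspace_iff:
  assumes K: "fun_space.subspace K" and "\<rho> \<in> K"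
  shows "(+) \<sigma> ` fun_space.span {\<rho>} \<subseteq> K \<longleftrightarrow> \<sigma> \<in> K"
proof
  have "\<sigma> + 0 \<in> (+) \<sigma> ` fun_space.span {\<rho>}" using fun_space.span_zero by blast
  then show "\<sigma> \<in> K" if "(+) \<sigma> ` fun_space.span {\<rho>} \<subseteq> K" using that by auto
  have "fun_space.span {\<rho>} \<subseteq> K" using assms by (simp add: fun_space.span_minimal)
  then show "(+) \<sigma> ` fun_space.span {\<rho>} \<subseteq> K" if "\<sigma> \<in> K"
    using that fun_space.subspace_add[OF K] by blast
qed

text \<open>The selection can be made after passing to cosets, where the two multisets already
  coincide.\<close>

lemma mset_cong_mod_filter:
  assumes "fun_space.subspace K" "\<rho> \<in> K" "mset_cong_mod M N \<rho>"
  shows "mset_cong_mod {#\<sigma> \<in># M. \<sigma> \<in> K#} {#\<sigma> \<in># N. \<sigma> \<in> K#} \<rho>"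
proof -
  let ?c = "\<lambda>\<sigma>. (+) \<sigma> ` fun_space.span {\<rho>}"
  have "image_mset ?c {#\<sigma> \<in># M. \<sigma> \<in> K#} = {#C \<in># image_mset ?c M. C \<subseteq> K#}" for M
    by (simp add: filter_mset_image_mset coset_subset_subspace_iff[OF assms(1,2)])
  with assms(3) show ?thesis by (simp add: mset_cong_mod_def)
qed

lemma colors_filter:
  "finite A \<Longrightarrow> {#\<sigma> \<in># colors \<alpha> A. \<sigma> \<in> K#} = colors \<alpha> {e \<in> A. \<alpha> e \<in> K}"
  by (simp add: colors_def filter_mset_image_mset)

lemma mset_cong_mod_size: "mset_cong_mod M N \<rho> \<Longrightarrow> size M = size N"
  unfolding mset_cong_mod_def by (metis size_image_mset)

lemma edges_at_color_subgraph:
  "edges_at (color_subgraph \<Gamma> \<alpha> K) p = {e \<in> edges_at \<Gamma> p. \<alpha> e \<in> K}"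
  by (auto simp: edges_at_def color_subgraph_def)

lemma finite_color_subgraph: "finite_mgraph \<Gamma> \<Longrightarrow> finite_mgraph (color_subgraph \<Gamma> \<alpha> K)"
  by (auto simp: finite_mgraph_def color_subgraph_def)

lemma color_compatible_color_subgraph:
  assumes fin: "finite_mgraph \<Gamma>" and comp: "color_compatible \<Gamma> \<alpha>" and K: "fun_space.subspace K"
  shows "color_compatible (color_subgraph \<Gamma> \<alpha> K) \<alpha>"
  unfolding color_compatible_def
proof (intro ballI allI impI)
  fix e p q
  assume e: "e \<in> edges (color_subgraph \<Gamma> \<alpha> K)" "ends (color_subgraph \<Gamma> \<alpha> K) e = {p, q}"
  then have "mset_cong_mod (colors \<alpha> (edges_at \<Gamma> p)) (colors \<alpha> (edges_at \<Gamma> q)) (\<alpha> e)"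
    using comp by (auto simp: color_compatible_def color_subgraph_def)
  from mset_cong_mod_filter[OF K _ this] e(1)
  show "mset_cong_mod (colors \<alpha> (edges_at (color_subgraph \<Gamma> \<alpha> K) p))
     (colors \<alpha> (edges_at (color_subgraph \<Gamma> \<alpha> K) q)) (\<alpha> e)"
    \<comment> \<open>\<open>edges_at_color_subgraph\<close> matches only the folded form, so
      \<open>color_subgraph\<close> is unfolded afterwards, to see that the color of
      \<open>e\<close> lies in \<open>K\<close>.\<close>
    by (simp add: edges_at_color_subgraph colors_filter finite_edges_at[OF fin])
      (simp add: color_subgraph_def)
qed

lemma color_compatible_component:
  assumes "finite_mgraph \<Gamma>" "color_compatible \<Gamma> \<alpha>"
  shows "color_compatible (component \<Gamma> p) \<alpha>"
  unfolding color_compatible_def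
proof (intro ballI allI impI)
  fix e q r
  assume e: "e \<in> edges (component \<Gamma> p)" "ends (component \<Gamma> p) e = {q, r}"
  then have "q \<in> verts (component \<Gamma> p)" "r \<in> verts (component \<Gamma> p)"
    by (auto simp: component_def)
  with e assms show "mset_cong_mod (colors \<alpha> (edges_at (component \<Gamma> p) q))
     (colors \<alpha> (edges_at (component \<Gamma> p) r)) (\<alpha> e)"
    by (simp add: edges_at_component) (simp add: color_compatible_def component_def)
qed

text \<open>Congruent multisets have the same size, so the valency cannot change along an edge.
  Applied to a color subgraph, this makes its component regular.\<close>

lemma card_edges_at_reachable:
  assumes comp: "color_compatible \<Gamma> \<alpha>" and "(p, q) \<in> (adjacency \<Gamma>)\<^sup>*"
  shows "card (edges_at \<Gamma> q) = card (edges_at \<Gamma> p)"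
  using assms(2)
proof induction
  case (step q r)
  then obtain e where "e \<in> edges \<Gamma>" "ends \<Gamma> e = {q, r}" by (auto simp: adjacency_def)
  then have "mset_cong_mod (colors \<alpha> (edges_at \<Gamma> q)) (colors \<alpha> (edges_at \<Gamma> r)) (\<alpha> e)"
    using comp by (simp add: color_compatible_def)
  from mset_cong_mod_size[OF this] step.IH show ?case by (simp add: colors_def)
qed simp

section \<open>Dimension counts and subsets of independent families\<close>

text \<open>A vector of \<open>span T\<close> outside \<open>span B\<close> would extend
  \<open>B\<close> to an independent set larger than \<open>T\<close>. Later \<open>T\<close>
  consists of the colors of \<open>S\<close>, and \<open>B\<close> of the colors at another vertex
  of the component.\<close>

lemma (in vector_space) independent_card_span_eq:
  assumes "finite T" "independent B" "B \<subseteq> span T" "card T \<le> card B"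
  shows "span B = span T"
proof
  show "span B \<subseteq> span T" using assms(3) by (simp add: span_minimal)
  have B: "finite B" using independent_span_bound[OF assms(1-3)] by simp
  have "x \<in> span B" if x: "x \<in> span T" for x
  proof (rule ccontr)
    assume nx: "x \<notin> span B"
    then have "independent (insert x B)" "x \<notin> B"
      using assms(2) independent_insert span_base by auto
    with independent_span_bound[OF assms(1), of "insert x B"] assms(3) x B
    have "Suc (card B) \<le> card T" by auto
    with assms(4) show False by simp
  qed
  then show "span T \<subseteq> span B" by blast
qed

text \<open>A dependent \<open>T\<close> could lose one element without changing its span, leaving
  too few vectors to span the independent set \<open>B\<close>.\<close>

lemma (in vector_space) spanning_card_independent:
  assumes "finite T" "independent B" "B \<subseteq> span T" "card T \<le> card B"
  shows "independent T"
proof (rule ccontr)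
  assume "\<not> independent T"
  then obtain t where t: "t \<in> T" "t \<in> span (T - {t})" by (auto simp: dependent_def)
  then have "span (T - {t}) = span T" by (metis span_redundant insert_Diff)
  then have "card B \<le> card (T - {t})"
    using independent_span_bound[of "T - {t}" B] assms by simp
  also have "\<dots> < card T" using t(1) assms(1) by (rule card_Diff1_less[rotated])
  finally show False using assms(4) by simp
qed

text \<open>\<open>l_independent\<close> speaks of exactly \<open>l\<close> edges. A smaller set is
  enlarged to \<open>l\<close> edges, which the valency \<open>n\<close> allows, and independence
  passes back to it.\<close>

lemma l_independentD:
  assumes "l_independent l \<Gamma> \<alpha>" "finite_mgraph \<Gamma>" "valent n \<Gamma>" "l \<le> n"
    and "p \<in> verts \<Gamma>" "A \<subseteq> edges_at \<Gamma> p" "card A \<le> l"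
  shows "inj_on \<alpha> A" "fun_space.independent (\<alpha> ` A)"
proof -
  have "card (edges_at \<Gamma> p) = n" using assms(3,5) by (simp add: valent_def)
  then obtain B where B: "A \<subseteq> B" "B \<subseteq> edges_at \<Gamma> p" "card B = l"
    using exists_subset_between[of A l "edges_at \<Gamma> p"] assms finite_edges_at[OF assms(2)] by auto
  then have "inj_on \<alpha> B" "fun_space.independent (\<alpha> ` B)"
    using assms(1,5) by (auto simp: l_independent_def)
  then show "inj_on \<alpha> A" "fun_space.independent (\<alpha> ` A)"
    using inj_on_subset[OF _ B(1)] fun_space.independent_mono[OF _ image_mono[OF B(1)]] by auto
qed

section \<open>Existence and uniqueness of faces\<close>

text \<open>Independence of \<open>m\<close> edges and \<open>closed\<close> together cover both
  applications: \<open>m\<close> below \<open>l\<close>, and \<open>m = n\<close> with rank equal to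
  valency.\<close>

proposition ex1_face:
  assumes skel: "abstract_1_skeleton n \<Gamma> \<alpha>"
    and indep: "\<And>q A. q \<in> verts \<Gamma> \<Longrightarrow> A \<subseteq> edges_at \<Gamma> q \<Longrightarrow> card A = m \<Longrightarrow>
        inj_on \<alpha> A \<and> fun_space.independent (\<alpha> ` A)"
    and p: "p \<in> verts \<Gamma>" and S: "S \<subseteq> edges_at \<Gamma> p" "card S = m"
    and closed: "\<And>e. e \<in> edges_at \<Gamma> p \<Longrightarrow> \<alpha> e \<in> fun_space.span (\<alpha> ` S) \<Longrightarrow> e \<in> S"
  shows "\<exists>!\<Gamma>'. face m \<Gamma> \<alpha> \<Gamma>' \<and> p \<in> verts \<Gamma>' \<and> S \<subseteq> edges \<Gamma>'"
proof -
  define K where "K = fun_space.span (\<alpha> ` S)"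
  define D where "D = color_subgraph \<Gamma> \<alpha> K"
  define C where "C = component D p"
  have fin: "finite_mgraph \<Gamma>" and comp: "color_compatible \<Gamma> \<alpha>" and Hom: "\<alpha> ` edges \<Gamma> \<subseteq> Hom"
    using skel by (auto simp: abstract_1_skeleton_def)
  have K: "fun_space.subspace K" by (simp add: K_def)
  have finD: "finite_mgraph D" and compD: "color_compatible D \<alpha>"
    using fin comp K by (simp_all add: D_def finite_color_subgraph color_compatible_color_subgraph)
  have pD: "p \<in> verts D" using p by (simp add: D_def color_subgraph_def)
  \<comment> \<open>By \<open>closed\<close>, no edge at \<open>p\<close> besides those of
    \<open>S\<close> has its color in \<open>K\<close>; this fixes the valency of the component at
    \<open>m\<close>.\<close>
  have DSp: "edges_at D p = S"
    using S(1) closed by (auto simp: D_def edges_at_color_subgraph K_def intro: fun_space.span_base)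
  have finS: "finite S" using S(1) fin by (auto intro: finite_subset finite_edges_at)
  have CD: "subgraph C D" unfolding C_def by (rule subgraph_component[OF finD pD])
  have C\<Gamma>: "subgraph C \<Gamma>" using CD by (auto simp: subgraph_def D_def color_subgraph_def)
  have C_at: "edges_at C q = edges_at D q" if "q \<in> verts C" for q
    using that unfolding C_def by (rule edges_at_component[OF finD])
  have card_at: "card (edges_at C q) = m" if q: "q \<in> verts C" for q
    using C_at[OF q] card_edges_at_reachable[OF compD, of p q] q DSp S(2)
    by (simp add: C_def component_def)
  have span_at: "fun_space.span (\<alpha> ` edges_at C q) = K" if q: "q \<in> verts C" for q
  proof -
    have qV: "q \<in> verts \<Gamma>" and sub: "edges_at C q \<subseteq> edges_at \<Gamma> q"
      using q C\<Gamma> by (auto simp: subgraph_def edges_at_def)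
    have ind: "inj_on \<alpha> (edges_at C q)" "fun_space.independent (\<alpha> ` edges_at C q)"
      using indep[OF qV sub card_at[OF q]] by auto
    \<comment> \<open>By injectivity there are exactly \<open>m\<close> colors at \<open>q\<close>,
      while the \<open>m\<close> edges of \<open>S\<close> have at most \<open>m\<close>
      colors.\<close>
    have "card (\<alpha> ` S) \<le> card (\<alpha> ` edges_at C q)"
      using card_image_le[OF finS, of \<alpha>] card_image[OF ind(1)] card_at[OF q] S(2) by simp
    moreover have "\<alpha> ` edges_at C q \<subseteq> fun_space.span (\<alpha> ` S)"
      using C_at[OF q] by (auto simp: D_def edges_at_color_subgraph K_def)
    ultimately show ?thesis unfolding K_def
      using ind(2) finS by (intro fun_space.independent_card_span_eq) auto
  qed
  have "K \<subseteq> Hom" unfolding K_def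
    using Hom S(1) by (intro fun_space.span_minimal subspace_Hom) (auto simp: edges_at_def)
  moreover have "color_compatible C \<alpha>"
    unfolding C_def by (rule color_compatible_component[OF finD compD])
  moreover have "connected_mgraph C" unfolding C_def by (rule connected_component)
  ultimately have faceC: "face m \<Gamma> \<alpha> C"
    using C\<Gamma> card_at span_at K by (auto simp: face_def valent_def)
  have pC: "p \<in> verts C" by (simp add: C_def component_def)
  then have SC: "S \<subseteq> edges C" using C_at DSp by (auto simp: edges_at_def)
  show ?thesis
  proof (intro ex1I[of _ C] conjI)
    fix F assume "face m \<Gamma> \<alpha> F \<and> p \<in> verts F \<and> S \<subseteq> edges F"
    then have F: "face m \<Gamma> \<alpha> F" and pF: "p \<in> verts F" and SF: "S \<subseteq> edges F" by auto
    then have F\<Gamma>: "subgraph F \<Gamma>" and connF: "connected_mgraph F"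
      and cardF: "\<And>q. q \<in> verts F \<Longrightarrow> card (edges_at F q) = m"
      by (auto simp: face_def valent_def)
    obtain K' where K': "\<And>q. q \<in> verts F \<Longrightarrow> fun_space.span (\<alpha> ` edges_at F q) = K'"
      using F by (auto simp: face_def)
    have finF: "finite_mgraph F" using F\<Gamma> by (simp add: subgraph_def)
    have "S \<subseteq> edges_at F p" using S(1) SF F\<Gamma> by (auto simp: edges_at_def subgraph_def)
    \<comment> \<open>\<open>F\<close> has just \<open>m\<close> edges at \<open>p\<close>, so
      \<open>S\<close> exhausts them and the subspace belonging to \<open>F\<close> has to be
      \<open>K\<close>.\<close>
    then have "S = edges_at F p"
      using finite_edges_at[OF finF] cardF[OF pF] S(2) by (intro card_subset_eq) auto
    then have "K' = K" using K'[OF pF] by (simp add: K_def)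
    have "edges_at F q \<subseteq> edges_at D q" if "q \<in> verts F" for q
      using F\<Gamma> K'[OF that] \<open>K' = K\<close> fun_space.span_base[of _ "\<alpha> ` edges_at F q"]
      unfolding D_def edges_at_color_subgraph by (auto simp: edges_at_def subgraph_def)
    \<comment> \<open>At a common vertex the edges of \<open>F\<close> lie among those of
      \<open>D\<close>, which are those of \<open>C\<close>; both sets have \<open>m\<close>
      elements.\<close>
    then have "edges_at F q = edges_at C q" if "q \<in> verts F" "q \<in> verts C" for q
      using that C_at cardF card_at finite_edges_at[OF finD] by (metis card_subset_eq)
    then show "F = C"
      using F\<Gamma> C\<Gamma> connF \<open>connected_mgraph C\<close> pF pC by (intro connected_subgraph_eqI) auto
  qed (use faceC pC SC in auto)
qed

text \<open>An edge outside \<open>S\<close> with color in the span of the colors of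
  \<open>S\<close> would give \<open>m + 1\<close> dependent edges. Strictness of
  \<open>m < l\<close> makes \<open>l\<close>-independence exclude this.\<close>

lemma ex1_face_of_l_independent:
  assumes skel: "abstract_1_skeleton n \<Gamma> \<alpha>"
    and l: "l_independent l \<Gamma> \<alpha>" "l \<le> n" and "m < l"
    and p: "p \<in> verts \<Gamma>" and S: "S \<subseteq> edges_at \<Gamma> p" "card S = m"
  shows "\<exists>!\<Gamma>'. face m \<Gamma> \<alpha> \<Gamma>' \<and> p \<in> verts \<Gamma>' \<and> S \<subseteq> edges \<Gamma>'"
proof (rule ex1_face[OF skel _ p S])
  have fin: "finite_mgraph \<Gamma>" "valent n \<Gamma>" using skel by (auto simp: abstract_1_skeleton_def)
  note ind = l_independentD[OF l(1) fin l(2)]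
  show "inj_on \<alpha> A \<and> fun_space.independent (\<alpha> ` A)"
    if "q \<in> verts \<Gamma>" "A \<subseteq> edges_at \<Gamma> q" "card A = m" for q A
    using ind[OF that(1,2)] that(3) \<open>m < l\<close> by simp
  fix e assume e: "e \<in> edges_at \<Gamma> p" "\<alpha> e \<in> fun_space.span (\<alpha> ` S)"
  show "e \<in> S"
  proof (rule ccontr)
    assume "e \<notin> S"
    have "finite S" using S(1) finite_edges_at[OF fin(1)] by (rule finite_subset)
    with \<open>e \<notin> S\<close> have "inj_on \<alpha> (insert e S)" "fun_space.independent (\<alpha> ` insert e S)"
      using ind[OF p, of "insert e S"] e(1) S \<open>m < l\<close> by auto
    with \<open>e \<notin> S\<close> e(2) show False
      by (auto simp: fun_space.independent_insert split: if_splits)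
  qed
qed

section \<open>Rank equal to valency\<close>

text \<open>The coordinate functions are independent elements of \<open>Hom\<close>, as many as the
  rank, and so bound the size of spanning sets from below.\<close>

lemma independent_coordinates:
  "fun_space.independent (range (\<lambda>(i :: 'k::finite) (x :: bit ^ 'k). x $ i))"
  and card_coordinates: "card (range (\<lambda>(i :: 'k::finite) (x :: bit ^ 'k). x $ i)) = CARD('k)"
proof -
  let ?c = "\<lambda>(i :: 'k) (x :: bit ^ 'k). x $ i"
  have axis: "?c j (axis i 1) = (if j = i then 1 else 0)" for i j
    by (simp add: axis_def)
  have inj: "inj ?c"
    by (rule injI) (metis axis one_neq_zero)
  then show "card (range ?c) = CARD('k)" by (rule card_image)
  show "fun_space.independent (range ?c)"
    unfolding fun_space.dependent_def
  proof safe
    fix i assume "?c i \<in> fun_space.span (range ?c - {?c i})"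
    \<comment> \<open>Evaluation at the \<open>i\<close>-th unit vector kills all the other
      coordinates, but not the \<open>i\<close>-th.\<close>
    moreover have "fun_space.span (range ?c - {?c i}) \<subseteq> {\<rho>. \<rho> (axis i 1) = 0}"
      by (intro fun_space.span_minimal)
        (auto simp: axis fun_space.subspace_def fun_scale_def axis_def)
    ultimately show False by (auto simp: axis_def)
  qed
qed

lemma coordinates_in_Hom: "(\<lambda>x :: bit ^ 'k. x $ i) \<in> Hom"
  by (simp add: Hom_def)

text \<open>The only candidate for \<open>A\<close> is the set of all edges at \<open>p\<close>.
  Their colors span \<open>Hom\<close>, so a count against the coordinate functions forces them to
  be distinct and independent.\<close>

lemma l_independent_rank:
  fixes \<alpha> :: "'e \<Rightarrow> bit ^ 'k \<Rightarrow> bit"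
  assumes skel: "abstract_1_skeleton CARD('k) \<Gamma> \<alpha>"
  shows "l_independent CARD('k) \<Gamma> \<alpha>"
  unfolding l_independent_def
proof (intro ballI allI impI)
  fix p A assume p: "p \<in> verts \<Gamma>" and A: "A \<subseteq> edges_at \<Gamma> p \<and> card A = CARD('k)"
  let ?B = "range (\<lambda>(i :: 'k) (x :: bit ^ 'k). x $ i)"
  have fin: "finite (edges_at \<Gamma> p)" and card: "card (edges_at \<Gamma> p) = CARD('k)"
    and span: "fun_space.span (\<alpha> ` edges_at \<Gamma> p) = Hom"
    using skel p finite_edges_at by (auto simp: abstract_1_skeleton_def valent_def)
  have AE: "A = edges_at \<Gamma> p" using A fin card by (intro card_subset_eq) auto
  have B: "?B \<subseteq> fun_space.span (\<alpha> ` A)" using AE span coordinates_in_Hom by auto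
  have finA: "finite (\<alpha> ` A)" using AE fin by simp
  have le: "card (\<alpha> ` A) \<le> card ?B"
    using card_image_le[of A \<alpha>] A AE fin by (simp add: card_coordinates)
  have "card A \<le> card (\<alpha> ` A)"
    using fun_space.independent_span_bound[OF finA independent_coordinates B] A
    by (simp add: card_coordinates)
  then have "inj_on \<alpha> A"
    using card_image_le[of A \<alpha>] AE fin by (intro eq_card_imp_inj_on) auto
  with fun_space.spanning_card_independent[OF finA independent_coordinates B le]
  show "inj_on \<alpha> A \<and> fun_space.independent (\<alpha> ` A)" by simp
qed

theorem proposition3p1:
  fixes \<Gamma> :: "('v, 'e) mgraph"
    and \<alpha> :: "'e \<Rightarrow> bit ^ 'k \<Rightarrow> bit"
    and n :: nat
  assumes "abstract_1_skeleton n \<Gamma> \<alpha>"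
  shows "(\<forall>l. 1 < l \<and> l \<le> CARD('k) \<and> l_independent l \<Gamma> \<alpha> \<longrightarrow>
            (\<forall>p\<in>verts \<Gamma>. \<forall>m<l. \<forall>S. S \<subseteq> edges_at \<Gamma> p \<and> card S = m \<longrightarrow>
               (\<exists>!\<Gamma>'. face m \<Gamma> \<alpha> \<Gamma>' \<and> p \<in> verts \<Gamma>' \<and> S \<subseteq> edges \<Gamma>'))) \<and>
         (CARD('k) = n \<longrightarrow>
            (\<forall>p\<in>verts \<Gamma>. \<forall>m\<le>n. \<forall>S. S \<subseteq> edges_at \<Gamma> p \<and> card S = m \<longrightarrow>
               (\<exists>!\<Gamma>'. face m \<Gamma> \<alpha> \<Gamma>' \<and> p \<in> verts \<Gamma>' \<and> S \<subseteq> edges \<Gamma>')))"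
proof (intro conjI allI ballI impI; (elim conjE)?)
  fix l p m S
  assume "l \<le> CARD('k)" "l_independent l \<Gamma> \<alpha>" "p \<in> verts \<Gamma>" "m < l"
    "S \<subseteq> edges_at \<Gamma> p" "card S = m"
  moreover have "CARD('k) \<le> n" using assms by (simp add: abstract_1_skeleton_def)
  ultimately show "\<exists>!\<Gamma>'. face m \<Gamma> \<alpha> \<Gamma>' \<and> p \<in> verts \<Gamma>' \<and> S \<subseteq> edges \<Gamma>'"
    by (intro ex1_face_of_l_independent[OF assms]) auto
next
  fix p m S
  assume n: "CARD('k) = n" and p: "p \<in> verts \<Gamma>" and m: "m \<le> n"
    and S: "S \<subseteq> edges_at \<Gamma> p" "card S = m"
  have ind: "l_independent n \<Gamma> \<alpha>" using l_independent_rank assms n by auto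
  show "\<exists>!\<Gamma>'. face m \<Gamma> \<alpha> \<Gamma>' \<and> p \<in> verts \<Gamma>' \<and> S \<subseteq> edges \<Gamma>'"
  proof (cases "m < n")
    case True
    then show ?thesis by (intro ex1_face_of_l_independent[OF assms ind _ _ p S]) auto
  next
    case False
    have "finite (edges_at \<Gamma> p)" "card (edges_at \<Gamma> p) = n"
      using assms p finite_edges_at by (auto simp: abstract_1_skeleton_def valent_def)
    then have "S = edges_at \<Gamma> p" using S m False by (intro card_subset_eq) auto
    then show ?thesis
      using ind m False by (intro ex1_face[OF assms _ p S]) (auto simp: l_independent_def)
  qed
qed

end
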